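(* Let $\{A_n\}$ and $\{B_n\}$ be sequences of $n\times n$ matrices having exponential decay with respect to common associated distance functions $d_n(i,j)$, and assume that both sequences also have a finite number of indices around each index for any $n$ (with respect to these $d_n$). Let $C_n=A_nB_n$ and $\tilde C_n=\tilde A_n\tilde B_n$, where $$[\tilde A_n]_{i,j}=\begin{cases}0,&\text{if }|[A_n]_{i,j}|<\tau,\\ [A_n]_{i,j},&\text{otherwise},\end{cases}\qquad [\tilde B_n]_{i,j}=\begin{cases}0,&\text{if }|[B_n]_{i,j}|<\tau,\\ [B_n]_{i,j},&\text{otherwise},\end{cases}$$ are the truncated matrices and $\tau>0$ is some given parameter. Then the error matrix $E_n=C_n-\tilde C_n$ has the following element-wise property: $$|[E_n]_{i,j}|=O(\tau),\qquad \forall i,j=1,\ldots,n.$$ Moreover, $$\|E_n\|_F=\begin{cases}O(n^{1/2}),& n\to\infty,\\ O(\tau^{p/2}),\ \forall p<2,& \tau\to 0,\end{cases}$$ where the first case is for fixed $\tau$ and the second is for fixed $n$.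
   Context: $\|\cdot\|_F$ is the Frobenius norm. Distance function: $d_n$ is a distance function on the index set $\{1,\ldots,n\}$ if for any indices $i,j,k$: $d_n(i,j)\ge 0$; $d_n(i,j)=d_n(j,i)$; $d_n(i,i)=0$; $d_n(i,j)\le d_n(i,k)+d_n(k,j)$ (i.e. it is a pseudo-metric). For each $n$ one such $d_n$ is given. Exponential decay with respect to common associated distance functions: there exist positive constants $\alpha,c_1,c_2$, independent of $n$, such that for each $n$ and all $i,j=1,\ldots,n$, $$|[A_n]_{i,j}|\le c_1e^{-\alpha d_n(i,j)},\qquad |[B_n]_{i,j}|\le c_2e^{-\alpha d_n(i,j)}.$$ Finite number of indices around each index for any $n$: there exist positive constants $\gamma$ and $\beta$, independent of $n$, such that $$|N_{d_n}(i,R)|\le\gamma R^\beta,\qquad \forall i=1,\ldots,n,\ \forall R>0,$$ where $N_{d_n}(i,R)$ is the set of all indices within a distance $R$ away from the $i$-th index (distances measured by $d_n$), and $|N_{d_n}(i,R)|$ is its cardinality.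
   Formalization: The bound |N(i,R)| ≤ γR^β is required only for R ≥ 1 instead of all R > 0: since i itself lies in N(i,R), the printed condition would force 1 ≤ γR^β for arbitrarily small R, which is impossible; the condition used is weaker, so the theorem is more general. *)

theory Defs
  imports
    Complex_Main
    "HOL-Library.Landau_Symbols"
    "Jordan_Normal_Form.Matrix"
begin

(* A sequence of n x n matrices is a function A :: nat => 'a mat with A n in carrier_mat n n.
   The index set {1,...,n} appears 0-based, as {0,...,n-1}.  The entry type is an arbitrary
   real_normed_field, which covers real as well as complex matrices. *)

definition index_distance :: "nat \<Rightarrow> (nat \<Rightarrow> nat \<Rightarrow> real) \<Rightarrow> bool" where
  "index_distance n \<delta> \<longleftrightarrow>
     (\<forall>i<n. \<forall>j<n. \<forall>k<n.
        \<delta> i j \<ge> 0 \<and> \<delta> i j = \<delta> j i \<and> \<delta> i i = 0 \<and> \<delta> i j \<le> \<delta> i k + \<delta> k j)"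

(* One set of constants, and in particular one rate alpha, serves all n. *)
definition exponential_decay ::
    "(nat \<Rightarrow> nat \<Rightarrow> nat \<Rightarrow> real) \<Rightarrow> (nat \<Rightarrow> 'a::real_normed_field mat) \<Rightarrow> (nat \<Rightarrow> 'a mat) \<Rightarrow> bool" where
  "exponential_decay d A B \<longleftrightarrow>
     (\<exists>\<alpha>>0. \<exists>c\<^sub>1>0. \<exists>c\<^sub>2>0. \<forall>n. \<forall>i<n. \<forall>j<n.
        norm (A n $$ (i, j)) \<le> c\<^sub>1 * exp (- \<alpha> * d n i j) \<and>
        norm (B n $$ (i, j)) \<le> c\<^sub>2 * exp (- \<alpha> * d n i j))"

definition neighbourhood :: "nat \<Rightarrow> (nat \<Rightarrow> nat \<Rightarrow> real) \<Rightarrow> nat \<Rightarrow> real \<Rightarrow> nat set" where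
  "neighbourhood n \<delta> i R = {j. j < n \<and> \<delta> i j \<le> R}"

(* The bound is required for R >= 1 only.  Since d(i,i) = 0 puts i into each of its own
   neighbourhoods, demanding it for every R > 0 would be contradictory: the cardinality is at
   least 1 while gamma * R^beta tends to 0 as R -> 0.  The version below is implied both by the
   bound for all R > 0 and by the bound for all R > 0 on the neighbours other than i; see the
   three lemmas that follow. *)
definition finite_neighbourhoods :: "(nat \<Rightarrow> nat \<Rightarrow> nat \<Rightarrow> real) \<Rightarrow> bool" where
  "finite_neighbourhoods d \<longleftrightarrow>
     (\<exists>\<gamma>>0. \<exists>\<beta>>0. \<forall>n. \<forall>i<n. \<forall>R\<ge>1.
        real (card (neighbourhood n (d n) i R)) \<le> \<gamma> * R powr \<beta>)"

lemma finite_neighbourhoods_if_all_radii: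
  assumes "\<gamma> > 0" "\<beta> > 0"
    and "\<And>n i R. i < n \<Longrightarrow> R > 0 \<Longrightarrow> real (card (neighbourhood n (d n) i R)) \<le> \<gamma> * R powr \<beta>"
  shows "finite_neighbourhoods d"
  unfolding finite_neighbourhoods_def
  by (rule exI[of _ \<gamma>], rule conjI, rule assms(1), rule exI[of _ \<beta>]) (use assms in auto)

lemma finite_neighbourhoods_if_punctured:
  assumes "\<gamma> > 0" "\<beta> > 0"
    and bound: "\<And>n i R. i < n \<Longrightarrow> R > 0 \<Longrightarrow>
           real (card (neighbourhood n (d n) i R - {i})) \<le> \<gamma> * R powr \<beta>"
  shows "finite_neighbourhoods d"
proof -
  have "real (card (neighbourhood n (d n) i R)) \<le> (\<gamma> + 1) * R powr \<beta>"
    if "i < n" "R \<ge> 1" for n i R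
  proof -
    have "card (neighbourhood n (d n) i R) \<le> card (insert i (neighbourhood n (d n) i R - {i}))"
      by (intro card_mono) (auto simp: neighbourhood_def)
    also have "\<dots> = card (neighbourhood n (d n) i R - {i}) + 1"
      by (subst card_insert_disjoint) (auto simp: neighbourhood_def)
    finally have "real (card (neighbourhood n (d n) i R)) \<le> \<gamma> * R powr \<beta> + 1"
      using bound[of i n R] that by linarith
    moreover have "1 \<le> R powr \<beta>"
      using that assms(2) by (simp add: ge_one_powr_ge_zero)
    ultimately show ?thesis by (simp add: algebra_simps)
  qed
  then show ?thesis
    unfolding finite_neighbourhoods_def
    by (intro exI[of _ "\<gamma> + 1"] conjI exI[of _ \<beta>]) (use assms in auto)
qed

lemma no_bound_for_all_radii:
  assumes "\<gamma> > 0" "\<beta> > 0" "index_distance n \<delta>" "i < n"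
  shows "\<not> (\<forall>R>0. real (card (neighbourhood n \<delta> i R)) \<le> \<gamma> * R powr \<beta>)"
proof
  assume bound: "\<forall>R>0. real (card (neighbourhood n \<delta> i R)) \<le> \<gamma> * R powr \<beta>"
  define R where "R = (1 / (2 * \<gamma>)) powr (1 / \<beta>)"
  have "R > 0" using assms by (simp add: R_def)
  have "i \<in> neighbourhood n \<delta> i R"
    using assms \<open>R > 0\<close> by (auto simp: neighbourhood_def index_distance_def)
  moreover have "finite (neighbourhood n \<delta> i R)" by (simp add: neighbourhood_def)
  ultimately have "1 \<le> card (neighbourhood n \<delta> i R)"
    by (metis One_nat_def Suc_leI card_gt_0_iff empty_iff)
  then have "1 \<le> \<gamma> * R powr \<beta>" using bound \<open>R > 0\<close> by (smt (verit) of_nat_1 of_nat_mono)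
  moreover have "R powr \<beta> = 1 / (2 * \<gamma>)"
    using assms by (simp add: R_def powr_powr)
  ultimately show False using assms by simp
qed

definition truncate_mat :: "real \<Rightarrow> 'a::real_normed_field mat \<Rightarrow> 'a mat" where
  "truncate_mat \<tau> M = map_mat (\<lambda>x. if norm x < \<tau> then 0 else x) M"

definition product_error :: "real \<Rightarrow> 'a::real_normed_field mat \<Rightarrow> 'a mat \<Rightarrow> 'a mat" where
  "product_error \<tau> M N = M * N - truncate_mat \<tau> M * truncate_mat \<tau> N"

definition frobenius_norm :: "'a::real_normed_field mat \<Rightarrow> real" where
  "frobenius_norm M = sqrt (\<Sum>i<dim_row M. \<Sum>j<dim_col M. (norm (M $$ (i, j)))\<^sup>2)"

end

theory Submission
  imports Defs "HOL-Analysis.L2_Norm" "HOL-Real_Asymp.Real_Asymp"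
begin

text \<open>
  The proof rests on one uniform estimate and two elementary ones.

  The uniform estimate (\<open>exp_decay_row_sums_bounded\<close>) says that the kernel
  \<open>exp (- \<alpha> * d i j)\<close> has row sums bounded independently of the row and of \<open>n\<close>: an index set of
  polynomial growth has at most \<open>\<gamma> * (m + 1) powr \<beta>\<close> indices at distance between \<open>m\<close> and \<open>m + 1\<close>,
  each of which contributes at most \<open>exp (- \<alpha> * m)\<close>, and the exponential wins.  As the distance is
  symmetric, column sums obey the same bound.

  The elementary estimates compare a product \<open>a * b\<close> of two scalars with the product of their
  truncations.  Truncation moves a scalar by at most \<open>\<tau>\<close> and does not increase its norm, so the
  two products differ by at most \<open>\<tau> * (norm a + norm b)\<close>.  On the other hand the truncated product
  is either \<open>a * b\<close> or zero, so they differ by at most \<open>norm a * norm b\<close>, whatever \<open>\<tau>\<close> is.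

  Summing the first one over the inner index of the matrix product, along a row of \<open>A\<close> and a column
  of \<open>B\<close>, bounds every entry of the error by a constant times \<open>\<tau>\<close>.  For fixed \<open>n\<close> the Frobenius
  norm is then even \<open>O(\<tau>)\<close>, which is stronger than the exponents \<open>p / 2 < 1\<close> require.
  Summing the second one twice bounds the absolute row sums of the error by a constant.  The
  Euclidean norm of a row is at most its absolute sum, so that the squared Frobenius norm is at most
  \<open>n\<close> times a constant; this bound is uniform in \<open>\<tau>\<close>.
\<close>

section \<open>Row sums of exponentially decaying kernels\<close>

text \<open>
  Half of the decay rate absorbs the power of \<open>m\<close>; the other half leaves a geometric series.
\<close>

lemma summable_poly_times_exp:
  fixes \<alpha> \<beta> \<gamma> :: real
  assumes "\<alpha> > 0"
  shows "summable (\<lambda>m. \<gamma> * (real m + 1) powr \<beta> * exp (- \<alpha> * real m))"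
proof (rule summable_comparison_test_bigo)
  have "summable (\<lambda>m. exp (- \<alpha> / 2) ^ m)"
    using assms by (intro summable_geometric) simp
  then show "summable (\<lambda>m. norm (exp (- \<alpha> / 2 * real m)))"
    by (simp flip: exp_of_nat_mult add: mult.commute)
  show "(\<lambda>m. \<gamma> * (real m + 1) powr \<beta> * exp (- \<alpha> * real m)) \<in> O(\<lambda>m. exp (- \<alpha> / 2 * real m))"
    using assms by (intro landau_o.small_imp_big) real_asymp
qed

text \<open>
  The indices are grouped into shells by the integer part \<open>m\<close> of their distance to \<open>i\<close>.  A shell lies
  in the neighbourhood of radius \<open>m + 1\<close>, and this radius is at least \<open>1\<close> even for the innermost
  shell, so that the growth bound applies to all of them.  The resulting series in \<open>m\<close> depends
  neither on \<open>i\<close> nor on \<open>n\<close>.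
\<close>

lemma exp_decay_row_sums_bounded:
  assumes "\<alpha> > 0" and "finite_neighbourhoods d"
    and nonneg: "\<And>n i j. i < n \<Longrightarrow> j < n \<Longrightarrow> d n i j \<ge> 0"
  obtains S where "S > 0" "\<And>n i. i < n \<Longrightarrow> (\<Sum>j<n. exp (- \<alpha> * d n i j)) \<le> S"
proof -
  obtain \<gamma> \<beta> where "\<gamma> > 0"
    and growth: "\<And>n i R. i < n \<Longrightarrow> R \<ge> 1 \<Longrightarrow>
      real (card (neighbourhood n (d n) i R)) \<le> \<gamma> * R powr \<beta>"
    using assms(2) unfolding finite_neighbourhoods_def by blast
  define f where "f m = \<gamma> * (real m + 1) powr \<beta> * exp (- \<alpha> * real m)" for m :: nat
  have "summable f"
    unfolding f_def using assms(1) by (rule summable_poly_times_exp)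
  have f_pos: "f m > 0" for m
    using \<open>\<gamma> > 0\<close> by (simp add: f_def)
  show thesis
  proof
    show "suminf f > 0"
      using \<open>summable f\<close> f_pos by (rule suminf_pos)
    fix n i :: nat
    assume "i < n"
    define shell where "shell j = nat \<lfloor>d n i j\<rfloor>" for j
    have shell: "real (shell j) \<le> d n i j" "d n i j \<le> real (shell j) + 1" if "j < n" for j
      using nonneg[OF \<open>i < n\<close> that] by (simp_all add: shell_def)
    have "(\<Sum>j<n. exp (- \<alpha> * d n i j))
        = (\<Sum>m\<in>shell ` {..<n}. \<Sum>j | j \<in> {..<n} \<and> shell j = m. exp (- \<alpha> * d n i j))"
      by (rule sum.group[symmetric]) auto
    also have "\<dots> \<le> (\<Sum>m\<in>shell ` {..<n}. f m)"
    proof (rule sum_mono)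
      fix m
      let ?J = "{j. j \<in> {..<n} \<and> shell j = m}"
      have "(\<Sum>j\<in>?J. exp (- \<alpha> * d n i j)) \<le> real (card ?J) * exp (- \<alpha> * real m)"
        using assms(1) shell(1) by (intro sum_bounded_above) auto
      also have "card ?J \<le> card (neighbourhood n (d n) i (real m + 1))"
        using shell(2) by (intro card_mono) (auto simp: neighbourhood_def)
      also have "real \<dots> \<le> \<gamma> * (real m + 1) powr \<beta>"
        using \<open>i < n\<close> by (intro growth) auto
      finally show "(\<Sum>j\<in>?J. exp (- \<alpha> * d n i j)) \<le> f m"
        by (simp add: f_def mult_right_mono)
    qed
    also have "\<dots> \<le> suminf f"
      using \<open>summable f\<close> f_pos by (intro sum_le_suminf) (auto intro: less_imp_le)
    finally show "(\<Sum>j<n. exp (- \<alpha> * d n i j)) \<le> suminf f" .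
  qed
qed

section \<open>Entries of the truncation error\<close>

text \<open>
  The two error bounds for scalars have complementary uses: the first is small with \<open>\<tau>\<close>, but it only
  decays in one of the factors at a time and so cannot be summed over a whole row of the error
  matrix; the second keeps the decay of both factors.
\<close>

lemma truncated_product_error_le_threshold:
  fixes a b :: "'a::real_normed_field"
  assumes "\<tau> > 0"
  shows "norm (a * b - (if norm a < \<tau> then 0 else a) * (if norm b < \<tau> then 0 else b))
    \<le> \<tau> * (norm a + norm b)"
proof -
  let ?a = "if norm a < \<tau> then 0 else a" and ?b = "if norm b < \<tau> then 0 else b"
  \<comment> \<open>Replacing one factor at a time leaves in each summand one truncation error, at most \<open>\<tau>\<close>.\<close>
  have "a * b - ?a * ?b = a * (b - ?b) + (a - ?a) * ?b"
    by (simp add: algebra_simps)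
  also have "norm \<dots> \<le> norm a * norm (b - ?b) + norm (a - ?a) * norm ?b"
    by (metis norm_mult norm_triangle_ineq)
  also have "\<dots> \<le> norm a * \<tau> + \<tau> * norm b"
    using assms by (intro add_mono mult_mono) auto
  finally show ?thesis by (simp add: algebra_simps)
qed

lemma truncated_product_error_le_product:
  fixes a b :: "'a::real_normed_field"
  shows "norm (a * b - (if norm a < \<tau> then 0 else a) * (if norm b < \<tau> then 0 else b))
    \<le> norm a * norm b"
  by (auto simp: norm_mult)

lemma product_error_entry:
  assumes "M \<in> carrier_mat n n" "N \<in> carrier_mat n n" "i < n" "j < n"
  shows "product_error \<tau> M N $$ (i, j) = (\<Sum>k<n. M $$ (i, k) * N $$ (k, j)
    - (if norm (M $$ (i, k)) < \<tau> then 0 else M $$ (i, k))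
      * (if norm (N $$ (k, j)) < \<tau> then 0 else N $$ (k, j)))"
  using assms unfolding product_error_def truncate_mat_def
  by (auto simp: scalar_prod_def sum_subtractf lessThan_atLeast0 intro!: sum.cong)

lemma product_error_entry_le_threshold:
  assumes "M \<in> carrier_mat n n" "N \<in> carrier_mat n n" "i < n" "j < n" "\<tau> > 0"
  shows "norm (product_error \<tau> M N $$ (i, j))
    \<le> \<tau> * ((\<Sum>k<n. norm (M $$ (i, k))) + (\<Sum>k<n. norm (N $$ (k, j))))"
  unfolding product_error_entry[OF assms(1-4)] sum.distrib[symmetric] sum_distrib_left
  by (intro sum_norm_le truncated_product_error_le_threshold assms(5))

text \<open>
  The maximal absolute row sum is a submultiplicative matrix norm; the entrywise bound by
  \<open>norm a * norm b\<close> lets the error of the truncated product inherit this from the full product.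
\<close>

lemma product_error_row_sum_le:
  assumes "M \<in> carrier_mat n n" "N \<in> carrier_mat n n" "i < n"
    and N_rows: "\<And>k. k < n \<Longrightarrow> (\<Sum>j<n. norm (N $$ (k, j))) \<le> t"
  shows "(\<Sum>j<n. norm (product_error \<tau> M N $$ (i, j))) \<le> (\<Sum>k<n. norm (M $$ (i, k))) * t"
proof -
  have "(\<Sum>j<n. norm (product_error \<tau> M N $$ (i, j)))
      \<le> (\<Sum>j<n. \<Sum>k<n. norm (M $$ (i, k)) * norm (N $$ (k, j)))"
  proof (rule sum_mono)
    fix j assume "j \<in> {..<n}"
    then have "j < n" by simp
    show "norm (product_error \<tau> M N $$ (i, j)) \<le> (\<Sum>k<n. norm (M $$ (i, k)) * norm (N $$ (k, j)))"
      unfolding product_error_entry[OF assms(1-3) \<open>j < n\<close>]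
      by (intro sum_norm_le truncated_product_error_le_product)
  qed
  also have "\<dots> = (\<Sum>k<n. norm (M $$ (i, k)) * (\<Sum>j<n. norm (N $$ (k, j))))"
    by (subst sum.swap) (simp add: sum_distrib_left)
  also have "\<dots> \<le> (\<Sum>k<n. norm (M $$ (i, k)) * t)"
    by (intro sum_mono mult_left_mono N_rows) auto
  finally show ?thesis by (simp add: sum_distrib_right)
qed

section \<open>Frobenius norm bounds\<close>

text \<open>
  Estimating all entries by a common constant would only give a bound of order \<open>n\<close>.  The gain to
  order \<open>sqrt n\<close> comes from bounding each row as a whole, its Euclidean norm by its absolute sum.
\<close>

lemma frobenius_norm_le_row_sums:
  assumes "M \<in> carrier_mat m n" and "r \<ge> 0"
    and rows: "\<And>i. i < m \<Longrightarrow> (\<Sum>j<n. norm (M $$ (i, j))) \<le> r"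
  shows "frobenius_norm M \<le> sqrt (real m) * r"
proof -
  have "(\<Sum>j<n. (norm (M $$ (i, j)))\<^sup>2) \<le> r\<^sup>2" if "i < m" for i
  proof -
    have "sqrt (\<Sum>j<n. (norm (M $$ (i, j)))\<^sup>2) \<le> (\<Sum>j<n. norm (M $$ (i, j)))"
      using L2_set_le_sum[of "{..<n}" "\<lambda>j. norm (M $$ (i, j))"] by (simp add: L2_set_def)
    also have "\<dots> \<le> r" using that by (rule rows)
    finally show ?thesis
      by (rule sqrt_le_D)
  qed
  then have "(\<Sum>i<m. \<Sum>j<n. (norm (M $$ (i, j)))\<^sup>2) \<le> (\<Sum>i<m. r\<^sup>2)"
    by (intro sum_mono) auto
  then have "sqrt (\<Sum>i<m. \<Sum>j<n. (norm (M $$ (i, j)))\<^sup>2) \<le> sqrt (real m * r\<^sup>2)"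
    by simp
  then show ?thesis
    using assms(1,2) by (simp add: frobenius_norm_def real_sqrt_mult)
qed

section \<open>The error of the truncated product\<close>

theorem theorem3p5:
  fixes A B :: "nat \<Rightarrow> 'a::real_normed_field mat"
    and d :: "nat \<Rightarrow> nat \<Rightarrow> nat \<Rightarrow> real"
  assumes "\<And>n. A n \<in> carrier_mat n n"
    and "\<And>n. B n \<in> carrier_mat n n"
    and "\<And>n. index_distance n (d n)"
    and "exponential_decay d A B"
    and "finite_neighbourhoods d"
  shows "(\<exists>K>0. \<forall>n. \<forall>\<tau>>0. \<forall>i<n. \<forall>j<n.
            norm (product_error \<tau> (A n) (B n) $$ (i, j)) \<le> K * \<tau>) \<and>
         (\<forall>\<tau>>0. (\<lambda>n. frobenius_norm (product_error \<tau> (A n) (B n)))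
            \<in> O(\<lambda>n. real n powr (1 / 2))) \<and>
         (\<forall>n. \<forall>p<2. (\<lambda>\<tau>. frobenius_norm (product_error \<tau> (A n) (B n)))
            \<in> O[at_right 0](\<lambda>\<tau>. \<tau> powr (p / 2)))"
proof -
  let ?E = "\<lambda>n \<tau>. product_error \<tau> (A n) (B n)"
  have carrier: "?E n \<tau> \<in> carrier_mat n n" for n \<tau>
    using assms(1)[of n] assms(2)[of n] unfolding product_error_def truncate_mat_def by auto
  have frob_nonneg: "frobenius_norm M \<ge> 0" for M :: "'a mat"
    by (simp add: frobenius_norm_def sum_nonneg)

  obtain \<alpha> c\<^sub>1 c\<^sub>2 where "\<alpha> > 0" "c\<^sub>1 > 0" "c\<^sub>2 > 0"
    and decay: "\<And>n i j. i < n \<Longrightarrow> j < n \<Longrightarrow> norm (A n $$ (i, j)) \<le> c\<^sub>1 * exp (- \<alpha> * d n i j)"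
      "\<And>n i j. i < n \<Longrightarrow> j < n \<Longrightarrow> norm (B n $$ (i, j)) \<le> c\<^sub>2 * exp (- \<alpha> * d n i j)"
    using assms(4) unfolding exponential_decay_def by blast
  have dist: "d n i j \<ge> 0" "d n i j = d n j i" if "i < n" "j < n" for n i j
    using assms(3)[of n] that unfolding index_distance_def by blast+
  obtain S where "S > 0" and S: "\<And>n i. i < n \<Longrightarrow> (\<Sum>j<n. exp (- \<alpha> * d n i j)) \<le> S"
    using exp_decay_row_sums_bounded[OF \<open>\<alpha> > 0\<close> assms(5) dist(1)] by metis

  have A_row: "(\<Sum>k<n. norm (A n $$ (i, k))) \<le> c\<^sub>1 * S" if "i < n" for n i
  proof -
    have "(\<Sum>k<n. norm (A n $$ (i, k))) \<le> c\<^sub>1 * (\<Sum>k<n. exp (- \<alpha> * d n i k))"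
      unfolding sum_distrib_left using decay(1) that by (intro sum_mono) auto
    also have "\<dots> \<le> c\<^sub>1 * S"
      using S[OF that] \<open>c\<^sub>1 > 0\<close> by (intro mult_left_mono) auto
    finally show ?thesis .
  qed
  have B_row: "(\<Sum>k<n. norm (B n $$ (i, k))) \<le> c\<^sub>2 * S" if "i < n" for n i
  proof -
    have "(\<Sum>k<n. norm (B n $$ (i, k))) \<le> c\<^sub>2 * (\<Sum>k<n. exp (- \<alpha> * d n i k))"
      unfolding sum_distrib_left using decay(2) that by (intro sum_mono) auto
    also have "\<dots> \<le> c\<^sub>2 * S"
      using S[OF that] \<open>c\<^sub>2 > 0\<close> by (intro mult_left_mono) auto
    finally show ?thesis .
  qed
  \<comment> \<open>Column sums of the kernel are row sums, by symmetry of the distance.\<close>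
  have B_col: "(\<Sum>k<n. norm (B n $$ (k, j))) \<le> c\<^sub>2 * S" if "j < n" for n j
  proof -
    have "(\<Sum>k<n. norm (B n $$ (k, j))) \<le> c\<^sub>2 * (\<Sum>k<n. exp (- \<alpha> * d n j k))"
      unfolding sum_distrib_left
    proof (rule sum_mono)
      fix k assume "k \<in> {..<n}"
      then show "norm (B n $$ (k, j)) \<le> c\<^sub>2 * exp (- \<alpha> * d n j k)"
        using decay(2)[of k n j] dist(2)[of k n j] that by simp
    qed
    also have "\<dots> \<le> c\<^sub>2 * S"
      using S[OF that] \<open>c\<^sub>2 > 0\<close> by (intro mult_left_mono) auto
    finally show ?thesis .
  qed

  define K where "K = c\<^sub>1 * S + c\<^sub>2 * S"
  have "K > 0"
    using \<open>c\<^sub>1 > 0\<close> \<open>c\<^sub>2 > 0\<close> \<open>S > 0\<close> by (simp add: K_def add_pos_pos)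
  have entry: "norm (?E n \<tau> $$ (i, j)) \<le> K * \<tau>" if "\<tau> > 0" "i < n" "j < n" for n \<tau> i j
  proof -
    have "norm (?E n \<tau> $$ (i, j))
        \<le> \<tau> * ((\<Sum>k<n. norm (A n $$ (i, k))) + (\<Sum>k<n. norm (B n $$ (k, j))))"
      using assms(1,2) that by (intro product_error_entry_le_threshold) auto
    also have "\<dots> \<le> \<tau> * K"
      unfolding K_def using that by (intro mult_left_mono add_mono A_row B_col) auto
    finally show ?thesis by (simp add: mult.commute)
  qed

  define L where "L = c\<^sub>1 * S * (c\<^sub>2 * S)"
  have "L > 0"
    using \<open>c\<^sub>1 > 0\<close> \<open>c\<^sub>2 > 0\<close> \<open>S > 0\<close> by (simp add: L_def)
  have frob_n: "frobenius_norm (?E n \<tau>) \<le> L * real n powr (1 / 2)" for n \<tau>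
  proof -
    have "(\<Sum>j<n. norm (?E n \<tau> $$ (i, j))) \<le> L" if "i < n" for i
    proof -
      have "(\<Sum>j<n. norm (?E n \<tau> $$ (i, j))) \<le> (\<Sum>k<n. norm (A n $$ (i, k))) * (c\<^sub>2 * S)"
        using assms(1,2) that B_row by (intro product_error_row_sum_le) auto
      also have "\<dots> \<le> L"
        unfolding L_def using A_row[OF that] \<open>c\<^sub>2 > 0\<close> \<open>S > 0\<close> by (intro mult_right_mono) auto
      finally show ?thesis .
    qed
    then have "frobenius_norm (?E n \<tau>) \<le> sqrt (real n) * L"
      using carrier \<open>L > 0\<close> by (intro frobenius_norm_le_row_sums) auto
    then show ?thesis by (simp add: powr_half_sqrt mult.commute)
  qed

  \<comment> \<open>For fixed \<open>n\<close> the dependence on \<open>n\<close> is immaterial, so the crude bound of a row sum by \<open>n\<close>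
    times the largest entry suffices.\<close>
  have frob_\<tau>: "frobenius_norm (?E n \<tau>) \<le> sqrt (real n) * (real n * K) * \<tau>" if "\<tau> > 0" for n \<tau>
  proof -
    have "(\<Sum>j<n. norm (?E n \<tau> $$ (i, j))) \<le> real n * (K * \<tau>)" if "i < n" for i
      using sum_bounded_above[of "{..<n}" "\<lambda>j. norm (?E n \<tau> $$ (i, j))" "K * \<tau>"]
        entry[OF \<open>\<tau> > 0\<close> that] by auto
    then have "frobenius_norm (?E n \<tau>) \<le> sqrt (real n) * (real n * (K * \<tau>))"
      using carrier \<open>K > 0\<close> that by (intro frobenius_norm_le_row_sums) auto
    then show ?thesis by (simp add: mult.assoc)
  qed

  show ?thesis
  proof (intro conjI allI impI)
    show "\<exists>K>0. \<forall>n. \<forall>\<tau>>0. \<forall>i<n. \<forall>j<n. norm (?E n \<tau> $$ (i, j)) \<le> K * \<tau>"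
      using \<open>K > 0\<close> entry by blast
  next
    fix \<tau> :: real
    show "(\<lambda>n. frobenius_norm (?E n \<tau>)) \<in> O(\<lambda>n. real n powr (1 / 2))"
      using frob_n frob_nonneg by (intro bigoI[of _ L] always_eventually) simp
  next
    fix n and p :: real
    assume "p < 2"
    have "(\<lambda>\<tau>. frobenius_norm (?E n \<tau>)) \<in> O[at_right 0](\<lambda>\<tau>. \<tau>)"
    proof (rule bigoI)
      show "\<forall>\<^sub>F \<tau> in at_right 0. norm (frobenius_norm (?E n \<tau>))
          \<le> sqrt (real n) * (real n * K) * norm \<tau>"
        using eventually_at_right_less[of 0] by eventually_elim (use frob_\<tau> frob_nonneg in auto)
    qed
    also have "(\<lambda>\<tau>. \<tau>) \<in> O[at_right 0](\<lambda>\<tau>. \<tau> powr (p / 2))"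
      using \<open>p < 2\<close> by real_asymp
    finally show "(\<lambda>\<tau>. frobenius_norm (?E n \<tau>)) \<in> O[at_right 0](\<lambda>\<tau>. \<tau> powr (p / 2))" .
  qed
qed

end
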